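(* (Cayley's Completeness Theorem for quantifier theories.) Let $\mathbf A$ be a locally finite quantifier theory over $\mathcal S$ and let $Z\in\mathcal S$ be an infinite set. Then the modification $\mathbf A[Z]$ of $\mathbf A$ by $Z$ is a faithful quantifier model of $\mathbf A$.
   Context: Throughout, $\mathcal S$ is a nonempty collection of sets containing at least one infinite set; $X,Y,Z,W$ denote members of $\mathcal S$ (sets of variables). Quantifier theory. A quantifier theory $\mathbf A$ over $\mathcal S$ consists of: a set $\mathbf A^*(X)$ and a map $\epsilon_X:X\to\mathbf A^*(X)$ for each $X$ (one writes $x$ for $\epsilon_X(x)$); a Boolean algebra $\mathbf A_*(X)$ for each $X$; an element $a\sigma\in\mathbf A^*(Y)$ for each nonempty $X$, $a\in\mathbf A^*(X)$ and map $\sigma:X\to\mathbf A^*(Y)$; an element $p\sigma\in\mathbf A_*(Y)$ for each nonempty $X$, $p\in\mathbf A_*(X)$ and map $\sigma:X\to\mathbf A^*(Y)$; an element $\forall x.p\in\mathbf A_*(X)$ for each nonempty $X$, $x\in X$, $p\in\mathbf A_*(X)$. Put $\mathbf A(X)=\mathbf A_*(X)\cup\mathbf A^*(X)$. For all nonempty $X$, $x\in X$, $t\in\mathbf A(X)$, $\sigma:X\to\mathbf A^*(Y)$, $p,q\in\mathbf A_*(X)$ the following hold. (P1) $t\epsilon_X=t$. (P2) $(t\sigma)\tau=t(\sigma\tau)$ if $Y$ is nonempty and $\tau:Y\to\mathbf A^*(W)$, where $(\sigma\tau)(x)=\sigma(x)\tau$. (P3) $x\sigma=\sigma(x)$. (P4)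 $p\mapsto p\sigma$ is a homomorphism of Boolean algebras $\mathbf A_*(X)\to\mathbf A_*(Y)$. (P5) $(\forall x.p)\sigma=\forall y.(p\sigma^{y/x})$ whenever $y,z\in Y$, $y\ne z$ and $\sigma[z/y]=\sigma$. (Q1) $\forall x.(p\wedge q)=\forall x.p\wedge\forall x.q$. (Q2) $\forall x.p\le p$. (Q3) $\forall x.p=p$ if $p[y/x]=p$ for some $y\in X$, $y\neq x$. Notation: for $y\in Y$ and $d\in\mathbf A^*(Y)$, $[d/y]:Y\to\mathbf A^*(Y)$ sends $y$ to $d$ and every other variable to itself; for $d\in \mathbf A^*(Y)$, $\sigma^{d/x}:X\to\mathbf A^*(Y)$ sends $x$ to $d$ and agrees with $\sigma$ elsewhere. Supports. For nonempty $X$ and $t\in\mathbf A(X)$, a subset $U\subseteq X$ is a support for $t$ if $t\sigma=t\tau$ for all $Y$ and all $\sigma,\tau:X\to\mathbf A^*(Y)$ with $\sigma|_U=\tau|_U$; $t$ is closed if $\emptyset$ is a support for $t$ (elements of $\mathbf A(\emptyset)$ are by definition closed). $\mathbf A$ is locally finite if every element of every $\mathbf A(X)$ has a finite support. Standing convention: every quantifier theory considered is nontrivial, meaning that $\mathbf A_*(X)$ has a non-closed element for some nonempty $X\in\mathcal S$. Models. A quantifier model is a quantifier theory $\mathbf B$ over a collection containing $\emptyset$ such that (M1) $\mathbf B^*(\emptyset)\neq\emptyset$ and $\mathbf B_*(\emptyset)$ is a nontrivial Boolean algebra ($0\ne1$); (M2) for nonempty $X$, $x\in X$, $p\in\mathbf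 B_*(X)$, $\sigma:X\to\mathbf B^*(\emptyset)$, the infimum $\bigwedge_{d\in\mathbf B^*(\emptyset)}p\sigma^{d/x}$ exists in $\mathbf B_*(\emptyset)$ and equals $(\forall x.p)\sigma$. A modification (resp. model) of a quantifier theory $\mathbf A$ over $\mathcal S$ is a quantifier theory (resp. quantifier model) $\mathbf B$ over $\mathcal S\cup\{\emptyset\}$ whose restriction to $\mathcal S\setminus\{\emptyset\}$ equals that of $\mathbf A$. The modification $\mathbf A[Z]$ (for nonempty $Z\in\mathcal S$): it agrees with $\mathbf A$ on $\mathcal S\setminus\{\emptyset\}$, $\mathbf A[Z]_*(\emptyset)=\mathbf A_*(Z)$, $\mathbf A[Z]^*(\emptyset)=\mathbf A^*(Z)$, and for nonempty $X$, $t\in\mathbf A(X)$ and $\sigma:X\to\mathbf A[Z]^*(\emptyset)=\mathbf A^*(Z)$, the element $t\sigma$ is the one given in $\mathbf A$. Faithful: a theory $\mathbf B$ over a collection containing $\emptyset$ is faithful if $\mathbf B^*(\emptyset)$ is nonempty and, for every nonempty $X$ and $t,s\in\mathbf B(X)$, $t=s$ iff $t\sigma=s\sigma$ for all $\sigma:X\to\mathbf B^*(\emptyset)$ (here $t,s$ are both in $\mathbf B_*(X)$ or both in $\mathbf B^*(X)$). *)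

theory Defs
  imports "HOL-Algebra.Lattice" "HOL-Library.FuncSet"
begin

section \<open>Boolean algebras with explicit carriers\<close>

definition complements :: "('p, 'm) gorder_scheme \<Rightarrow> 'p \<Rightarrow> 'p \<Rightarrow> bool" where
  "complements L p q \<longleftrightarrow> p \<sqinter>\<^bsub>L\<^esub> q = \<bottom>\<^bsub>L\<^esub> \<and> p \<squnion>\<^bsub>L\<^esub> q = \<top>\<^bsub>L\<^esub>"

locale boolean_lattice = bounded_lattice L for L (structure) +
  assumes meet_join_distrib:
      "\<lbrakk>p \<in> carrier L; q \<in> carrier L; r \<in> carrier L\<rbrakk>
        \<Longrightarrow> p \<sqinter> (q \<squnion> r) = (p \<sqinter> q) \<squnion> (p \<sqinter> r)"
    and complement_exists:
      "p \<in> carrier L \<Longrightarrow> \<exists>q\<in>carrier L. complements L p q"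

definition boolean_hom ::
  "('p, 'm) gorder_scheme \<Rightarrow> ('q, 'n) gorder_scheme \<Rightarrow> ('p \<Rightarrow> 'q) \<Rightarrow> bool" where
  "boolean_hom L M h \<longleftrightarrow>
     h \<in> carrier L \<rightarrow> carrier M \<and>
     (\<forall>p\<in>carrier L. \<forall>q\<in>carrier L.
        h (p \<sqinter>\<^bsub>L\<^esub> q) = h p \<sqinter>\<^bsub>M\<^esub> h q \<and>
        h (p \<squnion>\<^bsub>L\<^esub> q) = h p \<squnion>\<^bsub>M\<^esub> h q \<and>
        (complements L p q \<longrightarrow> complements M (h p) (h q))) \<and>
     h \<bottom>\<^bsub>L\<^esub> = \<bottom>\<^bsub>M\<^esub> \<and> h \<top>\<^bsub>L\<^esub> = \<top>\<^bsub>M\<^esub>"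


section \<open>Quantifier theories\<close>

text \<open>
  For a set of variables \<open>X\<close>, \<open>tms A X\<close> is $\mathbf A^*(X)$, \<open>fms A X\<close> is the Boolean algebra
  $\mathbf A_*(X)$, and \<open>var A X\<close> is $\epsilon_X$.  For \<open>\<sigma>\<close> from \<open>X\<close> to \<open>tms A Y\<close>,
  \<open>tsub A X Y a \<sigma>\<close> and \<open>fsub A X Y p \<sigma>\<close> are $a\sigma$ and $p\sigma$; \<open>fall A X x p\<close> is
  $\forall x.p$.  Elements of the two sorts live in different types, so axioms about
  $t \in \mathbf A(X)$ appear once for each sort.

  A map from \<open>X\<close> to \<open>tms A Y\<close> is an element of \<open>X \<rightarrow>\<^sub>E tms A Y\<close>, so that maps which agree
  on \<open>X\<close> are equal.
\<close>

record ('v, 't, 'p) qtheory =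
  tms  :: "'v set \<Rightarrow> 't set"
  fms  :: "'v set \<Rightarrow> 'p gorder"
  var  :: "'v set \<Rightarrow> 'v \<Rightarrow> 't"
  tsub :: "'v set \<Rightarrow> 'v set \<Rightarrow> 't \<Rightarrow> ('v \<Rightarrow> 't) \<Rightarrow> 't"
  fsub :: "'v set \<Rightarrow> 'v set \<Rightarrow> 'p \<Rightarrow> ('v \<Rightarrow> 't) \<Rightarrow> 'p"
  fall :: "'v set \<Rightarrow> 'v \<Rightarrow> 'p \<Rightarrow> 'p"

definition ident :: "('v, 't, 'p) qtheory \<Rightarrow> 'v set \<Rightarrow> 'v \<Rightarrow> 't" where
  "ident A X = (\<lambda>x\<in>X. var A X x)"

text \<open>The composite of \<open>\<sigma>\<close> from \<open>X\<close> to \<open>tms A Y\<close> and \<open>\<tau>\<close> from \<open>Y\<close> to \<open>tms A W\<close>.\<close>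

definition comp_sub ::
  "('v, 't, 'p) qtheory \<Rightarrow> 'v set \<Rightarrow> 'v set \<Rightarrow> 'v set \<Rightarrow> ('v \<Rightarrow> 't) \<Rightarrow> ('v \<Rightarrow> 't) \<Rightarrow> 'v \<Rightarrow> 't" where
  "comp_sub A X Y W \<sigma> \<tau> = (\<lambda>x\<in>X. tsub A Y W (\<sigma> x) \<tau>)"

text \<open>\<open>single A Y d y\<close> is $[d/y]$ on \<open>Y\<close>; the map $\sigma^{d/x}$ is simply \<open>\<sigma>(x := d)\<close>.\<close>

definition single :: "('v, 't, 'p) qtheory \<Rightarrow> 'v set \<Rightarrow> 't \<Rightarrow> 'v \<Rightarrow> 'v \<Rightarrow> 't" where
  "single A Y d y = (ident A Y)(y := d)"

locale pre_quantifier_theory =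
  fixes S :: "'v set set" and A :: "('v, 't, 'p) qtheory"
  assumes infinite_member: "\<exists>X\<in>S. infinite X"
    and var_closed: "\<lbrakk>X \<in> S; x \<in> X\<rbrakk> \<Longrightarrow> var A X x \<in> tms A X"
    and boolean_fms: "X \<in> S \<Longrightarrow> boolean_lattice (fms A X)"
    and tsub_closed:
      "\<lbrakk>X \<in> S; X \<noteq> {}; Y \<in> S; a \<in> tms A X; \<sigma> \<in> X \<rightarrow>\<^sub>E tms A Y\<rbrakk>
        \<Longrightarrow> tsub A X Y a \<sigma> \<in> tms A Y"
    and fsub_closed:
      "\<lbrakk>X \<in> S; X \<noteq> {}; Y \<in> S; p \<in> carrier (fms A X); \<sigma> \<in> X \<rightarrow>\<^sub>E tms A Y\<rbrakk>
        \<Longrightarrow> fsub A X Y p \<sigma> \<in> carrier (fms A Y)"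
    and fall_closed:
      "\<lbrakk>X \<in> S; x \<in> X; p \<in> carrier (fms A X)\<rbrakk> \<Longrightarrow> fall A X x p \<in> carrier (fms A X)"
    and P1_tms: "\<lbrakk>X \<in> S; X \<noteq> {}; a \<in> tms A X\<rbrakk> \<Longrightarrow> tsub A X X a (ident A X) = a"
    and P1_fms: "\<lbrakk>X \<in> S; X \<noteq> {}; p \<in> carrier (fms A X)\<rbrakk> \<Longrightarrow> fsub A X X p (ident A X) = p"
    and P2_tms:
      "\<lbrakk>X \<in> S; X \<noteq> {}; Y \<in> S; Y \<noteq> {}; W \<in> S; a \<in> tms A X;
        \<sigma> \<in> X \<rightarrow>\<^sub>E tms A Y; \<tau> \<in> Y \<rightarrow>\<^sub>E tms A W\<rbrakk>
        \<Longrightarrow> tsub A Y W (tsub A X Y a \<sigma>) \<tau> = tsub A X W a (comp_sub A X Y W \<sigma> \<tau>)"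
    and P2_fms:
      "\<lbrakk>X \<in> S; X \<noteq> {}; Y \<in> S; Y \<noteq> {}; W \<in> S; p \<in> carrier (fms A X);
        \<sigma> \<in> X \<rightarrow>\<^sub>E tms A Y; \<tau> \<in> Y \<rightarrow>\<^sub>E tms A W\<rbrakk>
        \<Longrightarrow> fsub A Y W (fsub A X Y p \<sigma>) \<tau> = fsub A X W p (comp_sub A X Y W \<sigma> \<tau>)"
    and P3:
      "\<lbrakk>X \<in> S; x \<in> X; Y \<in> S; \<sigma> \<in> X \<rightarrow>\<^sub>E tms A Y\<rbrakk> \<Longrightarrow> tsub A X Y (var A X x) \<sigma> = \<sigma> x"
    and P4:
      "\<lbrakk>X \<in> S; X \<noteq> {}; Y \<in> S; \<sigma> \<in> X \<rightarrow>\<^sub>E tms A Y\<rbrakk>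
        \<Longrightarrow> boolean_hom (fms A X) (fms A Y) (\<lambda>p. fsub A X Y p \<sigma>)"
    and P5:
      "\<lbrakk>X \<in> S; x \<in> X; Y \<in> S; \<sigma> \<in> X \<rightarrow>\<^sub>E tms A Y; p \<in> carrier (fms A X);
        y \<in> Y; z \<in> Y; y \<noteq> z; comp_sub A X Y Y \<sigma> (single A Y (var A Y z) y) = \<sigma>\<rbrakk>
        \<Longrightarrow> fsub A X Y (fall A X x p) \<sigma> = fall A Y y (fsub A X Y p (\<sigma>(x := var A Y y)))"
    and Q1:
      "\<lbrakk>X \<in> S; x \<in> X; p \<in> carrier (fms A X); q \<in> carrier (fms A X)\<rbrakk>
        \<Longrightarrow> fall A X x (p \<sqinter>\<^bsub>fms A X\<^esub> q) = fall A X x p \<sqinter>\<^bsub>fms A X\<^esub> fall A X x q"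
    and Q2:
      "\<lbrakk>X \<in> S; x \<in> X; p \<in> carrier (fms A X)\<rbrakk> \<Longrightarrow> fall A X x p \<sqsubseteq>\<^bsub>fms A X\<^esub> p"
    and Q3:
      "\<lbrakk>X \<in> S; x \<in> X; p \<in> carrier (fms A X); y \<in> X; y \<noteq> x;
        fsub A X X p (single A X (var A X y) x) = p\<rbrakk> \<Longrightarrow> fall A X x p = p"


section \<open>Supports\<close>

definition tm_support ::
  "'v set set \<Rightarrow> ('v, 't, 'p) qtheory \<Rightarrow> 'v set \<Rightarrow> 'v set \<Rightarrow> 't \<Rightarrow> bool" where
  "tm_support S A X U a \<longleftrightarrow> U \<subseteq> X \<and>
     (\<forall>Y\<in>S. \<forall>\<sigma>\<in>X \<rightarrow>\<^sub>E tms A Y. \<forall>\<tau>\<in>X \<rightarrow>\<^sub>E tms A Y.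
        (\<forall>u\<in>U. \<sigma> u = \<tau> u) \<longrightarrow> tsub A X Y a \<sigma> = tsub A X Y a \<tau>)"

definition fm_support ::
  "'v set set \<Rightarrow> ('v, 't, 'p) qtheory \<Rightarrow> 'v set \<Rightarrow> 'v set \<Rightarrow> 'p \<Rightarrow> bool" where
  "fm_support S A X U p \<longleftrightarrow> U \<subseteq> X \<and>
     (\<forall>Y\<in>S. \<forall>\<sigma>\<in>X \<rightarrow>\<^sub>E tms A Y. \<forall>\<tau>\<in>X \<rightarrow>\<^sub>E tms A Y.
        (\<forall>u\<in>U. \<sigma> u = \<tau> u) \<longrightarrow> fsub A X Y p \<sigma> = fsub A X Y p \<tau>)"

definition fm_closed ::
  "'v set set \<Rightarrow> ('v, 't, 'p) qtheory \<Rightarrow> 'v set \<Rightarrow> 'p \<Rightarrow> bool" where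
  "fm_closed S A X p \<longleftrightarrow> X = {} \<or> fm_support S A X {} p"

text \<open>Elements over the empty set of variables are closed by definition and have empty support.\<close>

definition locally_finite_theory :: "'v set set \<Rightarrow> ('v, 't, 'p) qtheory \<Rightarrow> bool" where
  "locally_finite_theory S A \<longleftrightarrow>
     (\<forall>X\<in>S. X \<noteq> {} \<longrightarrow>
        (\<forall>a\<in>tms A X. \<exists>U. finite U \<and> tm_support S A X U a) \<and>
        (\<forall>p\<in>carrier (fms A X). \<exists>U. finite U \<and> fm_support S A X U p))"

text \<open>By convention every quantifier theory is nontrivial.\<close>

locale quantifier_theory = pre_quantifier_theory +
  assumes nontrivial: "\<exists>X\<in>S. X \<noteq> {} \<and> (\<exists>p\<in>carrier (fms A X). \<not> fm_closed S A X p)"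


section \<open>Quantifier models\<close>

locale quantifier_model = quantifier_theory +
  assumes empty_member: "{} \<in> S"
    and M1_tms: "tms A {} \<noteq> {}"
    and M1_fms: "\<bottom>\<^bsub>fms A {}\<^esub> \<noteq> \<top>\<^bsub>fms A {}\<^esub>"
    and M2:
      "\<lbrakk>X \<in> S; x \<in> X; p \<in> carrier (fms A X); \<sigma> \<in> X \<rightarrow>\<^sub>E tms A {}\<rbrakk>
        \<Longrightarrow> is_glb (fms A {}) (fsub A X {} (fall A X x p) \<sigma>)
              ((\<lambda>d. fsub A X {} p (\<sigma>(x := d))) ` tms A {})"

text \<open>Equality of the restrictions of two theories to a collection of sets of variables.\<close>

definition agree_on ::
  "'v set set \<Rightarrow> ('v, 't, 'p) qtheory \<Rightarrow> ('v, 't, 'p) qtheory \<Rightarrow> bool" where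
  "agree_on S A B \<longleftrightarrow>
     (\<forall>X\<in>S. tms B X = tms A X \<and> carrier (fms B X) = carrier (fms A X) \<and>
        (\<forall>p\<in>carrier (fms A X). \<forall>q\<in>carrier (fms A X).
           p \<sqsubseteq>\<^bsub>fms B X\<^esub> q \<longleftrightarrow> p \<sqsubseteq>\<^bsub>fms A X\<^esub> q) \<and>
        (\<forall>x\<in>X. var B X x = var A X x \<and>
           (\<forall>p\<in>carrier (fms A X). fall B X x p = fall A X x p))) \<and>
     (\<forall>X\<in>S. \<forall>Y\<in>S. X \<noteq> {} \<longrightarrow> (\<forall>\<sigma>\<in>X \<rightarrow>\<^sub>E tms A Y.
        (\<forall>a\<in>tms A X. tsub B X Y a \<sigma> = tsub A X Y a \<sigma>) \<and>
        (\<forall>p\<in>carrier (fms A X). fsub B X Y p \<sigma> = fsub A X Y p \<sigma>)))"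

definition modification_of ::
  "'v set set \<Rightarrow> ('v, 't, 'p) qtheory \<Rightarrow> ('v, 't, 'p) qtheory \<Rightarrow> bool" where
  "modification_of S A B \<longleftrightarrow> quantifier_theory (S \<union> {{}}) B \<and> agree_on (S - {{}}) A B"

definition model_of ::
  "'v set set \<Rightarrow> ('v, 't, 'p) qtheory \<Rightarrow> ('v, 't, 'p) qtheory \<Rightarrow> bool" where
  "model_of S A B \<longleftrightarrow> quantifier_model (S \<union> {{}}) B \<and> agree_on (S - {{}}) A B"

text \<open>
  $\mathbf A[Z]$: the data over the empty set are replaced by the data of \<open>A\<close> over \<open>Z\<close>, also
  when the empty set already belongs to the collection over which \<open>A\<close> is given.
  Substitutions out of the empty set and quantification over it are not part of the data.
\<close>

definition modify_by :: "('v, 't, 'p) qtheory \<Rightarrow> 'v set \<Rightarrow> ('v, 't, 'p) qtheory" where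
  "modify_by A Z =
     (let at = (\<lambda>X. if X = {} then Z else X) in
      \<lparr> tms = (\<lambda>X. tms A (at X)),
        fms = (\<lambda>X. fms A (at X)),
        var = var A,
        tsub = (\<lambda>X Y. tsub A X (at Y)),
        fsub = (\<lambda>X Y. fsub A X (at Y)),
        fall = fall A \<rparr>)"

definition faithful_theory :: "'v set set \<Rightarrow> ('v, 't, 'p) qtheory \<Rightarrow> bool" where
  "faithful_theory S B \<longleftrightarrow> tms B {} \<noteq> {} \<and>
     (\<forall>X\<in>S. X \<noteq> {} \<longrightarrow>
        (\<forall>a\<in>tms B X. \<forall>b\<in>tms B X.
           a = b \<longleftrightarrow> (\<forall>\<sigma>\<in>X \<rightarrow>\<^sub>E tms B {}. tsub B X {} a \<sigma> = tsub B X {} b \<sigma>)) \<and>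
        (\<forall>p\<in>carrier (fms B X). \<forall>q\<in>carrier (fms B X).
           p = q \<longleftrightarrow> (\<forall>\<sigma>\<in>X \<rightarrow>\<^sub>E tms B {}. fsub B X {} p \<sigma> = fsub B X {} q \<sigma>)))"

end

theory Submission
  imports Defs
begin

text \<open>
  Since \<open>Z\<close> is infinite and all supports are finite, a substitution into \<open>Z\<close> may be changed off
  the relevant supports so that it takes finitely many values, and then some variable \<open>y\<close> of \<open>Z\<close>
  occurs in none of them.  For such a \<open>\<sigma>\<close>, axiom P5 turns $(\forall x.p)\sigma$ into
  $\forall y.q$ with $q = p\sigma^{y/x}$, and $q[d/y] = p\sigma^{d/x}$ for all \<open>d\<close>.
  By Q2 this makes $\forall y.q$ a lower bound; if \<open>y\<close> is also outside a support of a lower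
  bound \<open>r\<close>, then $r = \forall y.r \le \forall y.q$ by Q3 and Q1.  Faithfulness holds because
  an injection of a finite support into \<open>Z\<close> can be undone by a substitution.
\<close>

section \<open>Supports, bounded lattices and Boolean homomorphisms\<close>

lemma tm_supportD:
  assumes "tm_support S A X U a" "Y \<in> S" "\<sigma> \<in> X \<rightarrow>\<^sub>E tms A Y" "\<tau> \<in> X \<rightarrow>\<^sub>E tms A Y"
    "\<And>u. u \<in> U \<Longrightarrow> \<sigma> u = \<tau> u"
  shows "tsub A X Y a \<sigma> = tsub A X Y a \<tau>"
proof -
  have "\<forall>u\<in>U. \<sigma> u = \<tau> u"
    using assms(5) by simp
  moreover have "\<forall>Y\<in>S. \<forall>\<sigma>\<in>X \<rightarrow>\<^sub>E tms A Y. \<forall>\<tau>\<in>X \<rightarrow>\<^sub>E tms A Y.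
      (\<forall>u\<in>U. \<sigma> u = \<tau> u) \<longrightarrow> tsub A X Y a \<sigma> = tsub A X Y a \<tau>"
    using assms(1) unfolding tm_support_def by (rule conjunct2)
  ultimately show ?thesis
    using assms(2-4) by blast
qed

lemma fm_supportD:
  assumes "fm_support S A X U p" "Y \<in> S" "\<sigma> \<in> X \<rightarrow>\<^sub>E tms A Y" "\<tau> \<in> X \<rightarrow>\<^sub>E tms A Y"
    "\<And>u. u \<in> U \<Longrightarrow> \<sigma> u = \<tau> u"
  shows "fsub A X Y p \<sigma> = fsub A X Y p \<tau>"
proof -
  have "\<forall>u\<in>U. \<sigma> u = \<tau> u"
    using assms(5) by simp
  moreover have "\<forall>Y\<in>S. \<forall>\<sigma>\<in>X \<rightarrow>\<^sub>E tms A Y. \<forall>\<tau>\<in>X \<rightarrow>\<^sub>E tms A Y.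
      (\<forall>u\<in>U. \<sigma> u = \<tau> u) \<longrightarrow> fsub A X Y p \<sigma> = fsub A X Y p \<tau>"
    using assms(1) unfolding fm_support_def by (rule conjunct2)
  ultimately show ?thesis
    using assms(2-4) by blast
qed

lemma locally_finite_tm_support:
  assumes "locally_finite_theory S A" "X \<in> S" "X \<noteq> {}" "a \<in> tms A X"
  obtains U where "finite U" "tm_support S A X U a"
proof -
  have "\<exists>U. finite U \<and> tm_support S A X U a"
    using assms unfolding locally_finite_theory_def by blast
  then show thesis
    using that by blast
qed

lemma locally_finite_fm_support:
  assumes "locally_finite_theory S A" "X \<in> S" "X \<noteq> {}" "p \<in> carrier (fms A X)"
  obtains U where "finite U" "fm_support S A X U p"
proof -
  have "\<exists>U. finite U \<and> fm_support S A X U p"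
    using assms unfolding locally_finite_theory_def by blast
  then show thesis
    using that by blast
qed

lemma (in bounded_lattice) eq_if_bottom_eq_top:
  assumes "\<bottom> = \<top>" "p \<in> carrier L" "q \<in> carrier L"
  shows "p = q"
proof -
  have "r = \<bottom>" if "r \<in> carrier L" for r
    using le_antisym[OF _ bottom_lower[OF that] that bottom_closed] top_higher[OF that] assms(1)
    by simp
  from this[OF assms(2)] this[OF assms(3)] show ?thesis
    by simp
qed

lemma (in lattice) meet_absorb:
  assumes "x \<sqsubseteq> y" "x \<in> carrier L" "y \<in> carrier L"
  shows "x \<sqinter> y = x"
proof -
  have "x \<sqsubseteq> x \<sqinter> y"
    using assms by (intro meet_le) auto
  then show ?thesis
    using le_antisym[OF meet_left[OF assms(2,3)] _ meet_closed[OF assms(2,3)] assms(2)] by simp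
qed

lemma boolean_hom_mono:
  assumes "lattice L" "lattice M" "boolean_hom L M h"
    and "p \<in> carrier L" "q \<in> carrier L" "p \<sqsubseteq>\<^bsub>L\<^esub> q"
  shows "h p \<sqsubseteq>\<^bsub>M\<^esub> h q"
proof -
  have h: "h p \<in> carrier M" "h q \<in> carrier M" "h (p \<squnion>\<^bsub>L\<^esub> q) = h p \<squnion>\<^bsub>M\<^esub> h q"
    using assms(3-5) unfolding boolean_hom_def by auto
  \<comment> \<open>The order is recovered from joins, which \<open>h\<close> preserves.\<close>
  moreover have "p \<squnion>\<^bsub>L\<^esub> q = q"
    using lattice.le_iff_meet[OF assms(1,4,5)] assms(6) by simp
  ultimately show ?thesis
    using lattice.le_iff_meet[OF assms(2) h(1,2)] by simp
qed

section \<open>Monotonicity and substitution for a fresh variable\<close>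

context pre_quantifier_theory
begin

lemma bounded_lattice_fms: "X \<in> S \<Longrightarrow> bounded_lattice (fms A X)"
  by (rule boolean_lattice.axioms(1)[OF boolean_fms])

lemma lattice_fms: "X \<in> S \<Longrightarrow> lattice (fms A X)"
  by (rule bounded_lattice.axioms(1)[OF bounded_lattice_fms])

lemma ident_in: "X \<in> S \<Longrightarrow> ident A X \<in> X \<rightarrow>\<^sub>E tms A X"
  unfolding ident_def using var_closed by auto

lemma single_in:
  "\<lbrakk>Y \<in> S; y \<in> Y; d \<in> tms A Y\<rbrakk> \<Longrightarrow> single A Y d y \<in> Y \<rightarrow>\<^sub>E tms A Y"
  unfolding single_def ident_def using var_closed by (auto simp: PiE_def extensional_def)

lemma single_var [simp]: "y \<in> Y \<Longrightarrow> single A Y (var A Y y) y = ident A Y"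
  by (auto simp: single_def ident_def)

lemma fun_upd_in:
  "\<lbrakk>\<sigma> \<in> X \<rightarrow>\<^sub>E T; x \<in> X; d \<in> T\<rbrakk> \<Longrightarrow> \<sigma>(x := d) \<in> X \<rightarrow>\<^sub>E T"
  by (auto simp: PiE_def extensional_def)

lemma comp_sub_in:
  assumes "Y \<in> S" "Y \<noteq> {}" "W \<in> S" "\<sigma> \<in> X \<rightarrow>\<^sub>E tms A Y" "\<tau> \<in> Y \<rightarrow>\<^sub>E tms A W"
  shows "comp_sub A X Y W \<sigma> \<tau> \<in> X \<rightarrow>\<^sub>E tms A W"
  unfolding comp_sub_def using assms by (auto intro!: tsub_closed)

lemma fsub_mono:
  assumes "X \<in> S" "X \<noteq> {}" "Y \<in> S" "\<sigma> \<in> X \<rightarrow>\<^sub>E tms A Y"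
    and "p \<in> carrier (fms A X)" "q \<in> carrier (fms A X)" "p \<sqsubseteq>\<^bsub>fms A X\<^esub> q"
  shows "fsub A X Y p \<sigma> \<sqsubseteq>\<^bsub>fms A Y\<^esub> fsub A X Y q \<sigma>"
  using boolean_hom_mono[OF lattice_fms[OF assms(1)] lattice_fms[OF assms(3)] P4[OF assms(1-4)]]
    assms(5-7) .

text \<open>By Q1 quantification preserves meets, and \<open>p\<close> is the meet of
  \<open>p\<close> and \<open>q\<close>.\<close>

lemma fall_mono:
  assumes "X \<in> S" "x \<in> X" "p \<in> carrier (fms A X)" "q \<in> carrier (fms A X)"
    and "p \<sqsubseteq>\<^bsub>fms A X\<^esub> q"
  shows "fall A X x p \<sqsubseteq>\<^bsub>fms A X\<^esub> fall A X x q"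
proof -
  interpret lattice "fms A X"
    using lattice_fms assms(1) .
  have "fall A X x p = fall A X x p \<sqinter>\<^bsub>fms A X\<^esub> fall A X x q"
    using Q1[OF assms(1-4)] meet_absorb[OF assms(5,3,4)] by simp
  then show ?thesis
    using meet_right[OF fall_closed[OF assms(1-3)] fall_closed[OF assms(1,2,4)]] by simp
qed

text \<open>Off \<open>y\<close>, hence on the support, \<open>single A Y d y\<close> is the
  identity, so P1 applies whatever the term \<open>d\<close> is.\<close>

lemma tsub_single_fresh:
  assumes "Y \<in> S" "tm_support S A Y U a" "y \<in> Y" "y \<notin> U" "a \<in> tms A Y" "d \<in> tms A Y"
  shows "tsub A Y Y a (single A Y d y) = a"
proof -
  have "tsub A Y Y a (single A Y d y) = tsub A Y Y a (ident A Y)"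
    using assms by (intro tm_supportD[OF assms(2)] single_in ident_in) (auto simp: single_def)
  then show ?thesis
    using P1_tms assms by auto
qed

lemma fsub_single_fresh:
  assumes "Y \<in> S" "fm_support S A Y U p" "y \<in> Y" "y \<notin> U" "p \<in> carrier (fms A Y)" "d \<in> tms A Y"
  shows "fsub A Y Y p (single A Y d y) = p"
proof -
  have "fsub A Y Y p (single A Y d y) = fsub A Y Y p (ident A Y)"
    using assms by (intro fm_supportD[OF assms(2)] single_in ident_in) (auto simp: single_def)
  then show ?thesis
    using P1_fms assms by auto
qed

section \<open>Nontriviality\<close>

text \<open>
  \<open>W\<close> may be empty here, although P2 does not allow composition through the empty set: two values
  over \<open>W\<close> are reached from two distinct variables of \<open>Z\<close>.
\<close>

lemma closed_over_nonempty_sets: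
  assumes "X \<in> S" "X \<noteq> {}" and Z: "Z \<in> S" "z \<in> Z" "z' \<in> Z" "z \<noteq> z'"
    and p: "p \<in> carrier (fms A X)"
    and closed: "\<And>Y \<sigma> \<tau>. \<lbrakk>Y \<in> S; Y \<noteq> {}; \<sigma> \<in> X \<rightarrow>\<^sub>E tms A Y; \<tau> \<in> X \<rightarrow>\<^sub>E tms A Y\<rbrakk>
      \<Longrightarrow> fsub A X Y p \<sigma> = fsub A X Y p \<tau>"
    and W: "W \<in> S" and \<sigma>: "\<sigma> \<in> X \<rightarrow>\<^sub>E tms A W" and \<tau>: "\<tau> \<in> X \<rightarrow>\<^sub>E tms A W"
  shows "fsub A X W p \<sigma> = fsub A X W p \<tau>"
proof -
  obtain x where x: "x \<in> X"
    using assms by blast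
  define K where "K = (\<lambda>_\<in>X. var A X x)"
  define C where "C = (\<lambda>w. \<lambda>_\<in>X. var A Z w)"
  define \<rho> where "\<rho> = (\<lambda>_\<in>Z. \<sigma> x)(z' := \<tau> x)"
  have K: "K \<in> X \<rightarrow>\<^sub>E tms A X"
    unfolding K_def using assms x var_closed by auto
  \<comment> \<open>The identity and the collapse \<open>K\<close> of all variables to
    \<open>x\<close> act alike on \<open>p\<close>. Hence every substitution acts on
    \<open>p\<close> as a constant one, even when its target is the empty set.\<close>
  have pK: "fsub A X X p K = p"
    using closed[OF assms(1,2) K ident_in[OF assms(1)]] P1_fms[OF assms(1,2) p] by simp
  have const: "fsub A X W p \<upsilon> = fsub A X W p (\<lambda>_\<in>X. \<upsilon> x)" if "\<upsilon> \<in> X \<rightarrow>\<^sub>E tms A W" for \<upsilon>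
  proof -
    have "comp_sub A X X W K \<upsilon> = (\<lambda>_\<in>X. \<upsilon> x)"
      unfolding comp_sub_def K_def using P3[OF \<open>X \<in> S\<close> x W that] by auto
    then show ?thesis
      using P2_fms[OF assms(1,2,1,2) W p K that] pK by simp
  qed
  have \<rho>: "\<rho> \<in> Z \<rightarrow>\<^sub>E tms A W"
    unfolding \<rho>_def using \<sigma> \<tau> x Z by (intro fun_upd_in) auto
  have C: "C w \<in> X \<rightarrow>\<^sub>E tms A Z" if "w \<in> Z" for w
    unfolding C_def using that Z var_closed by auto
  have eval: "fsub A Z W (fsub A X Z p (C w)) \<rho> = fsub A X W p (\<lambda>_\<in>X. \<rho> w)" if "w \<in> Z" for w
  proof -
    have "comp_sub A X Z W (C w) \<rho> = (\<lambda>_\<in>X. \<rho> w)"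
      unfolding comp_sub_def C_def using P3[OF Z(1) that W \<rho>] by auto
    then show ?thesis
      using P2_fms[OF assms(1,2) Z(1) _ W p C[OF that] \<rho>] Z by auto
  qed
  \<comment> \<open>Over the nonempty set \<open>Z\<close> the two constants cannot be told apart;
    applying \<open>\<rho>\<close>, which sends \<open>z\<close> to \<open>\<sigma> x\<close> and
    \<open>z'\<close> to \<open>\<tau> x\<close>, carries this equality over to
    \<open>W\<close>.\<close>
  have "fsub A X Z p (C z) = fsub A X Z p (C z')"
    using closed C Z by blast
  then have "fsub A X W p (\<lambda>_\<in>X. \<sigma> x) = fsub A X W p (\<lambda>_\<in>X. \<tau> x)"
    using eval[of z] eval[of z'] Z by (simp add: \<rho>_def)
  then show ?thesis
    using const[OF \<sigma>] const[OF \<tau>] by simp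
qed

text \<open>A collapse of the algebra over \<open>Z\<close> spreads along any homomorphism out of
  it. Some algebra over a set \<open>Y\<close> has two distinct elements, namely two values of the
  non-closed \<open>p\<close>, and a constant substitution from \<open>Z\<close> to \<open>Y\<close>
  exists because \<open>\<sigma> x\<close> is a term over \<open>Y\<close>.\<close>

lemma nontrivial_fms:
  assumes "X \<in> S" "X \<noteq> {}" "p \<in> carrier (fms A X)" "\<not> fm_closed S A X p"
    and "Z \<in> S" "Z \<noteq> {}"
  shows "\<bottom>\<^bsub>fms A Z\<^esub> \<noteq> \<top>\<^bsub>fms A Z\<^esub>"
proof
  assume trivial: "\<bottom>\<^bsub>fms A Z\<^esub> = \<top>\<^bsub>fms A Z\<^esub>"
  obtain Y \<sigma> \<tau> where Y: "Y \<in> S" "\<sigma> \<in> X \<rightarrow>\<^sub>E tms A Y" "\<tau> \<in> X \<rightarrow>\<^sub>E tms A Y"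
    and ne: "fsub A X Y p \<sigma> \<noteq> fsub A X Y p \<tau>"
    using assms unfolding fm_closed_def fm_support_def by blast
  obtain x where "x \<in> X"
    using assms by blast
  then have subst: "(\<lambda>_\<in>Z. \<sigma> x) \<in> Z \<rightarrow>\<^sub>E tms A Y"
    using Y by auto
  have "fsub A Z Y \<bottom>\<^bsub>fms A Z\<^esub> (\<lambda>_\<in>Z. \<sigma> x) = \<bottom>\<^bsub>fms A Y\<^esub>"
    "fsub A Z Y \<top>\<^bsub>fms A Z\<^esub> (\<lambda>_\<in>Z. \<sigma> x) = \<top>\<^bsub>fms A Y\<^esub>"
    using P4[OF assms(5,6) Y(1) subst] by (simp_all add: boolean_hom_def)
  with trivial have "\<bottom>\<^bsub>fms A Y\<^esub> = \<top>\<^bsub>fms A Y\<^esub>"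
    by simp
  then have "fsub A X Y p \<sigma> = fsub A X Y p \<tau>"
    using bounded_lattice.eq_if_bottom_eq_top[OF bounded_lattice_fms[OF Y(1)] _
        fsub_closed[OF assms(1,2) Y(1) assms(3) Y(2)] fsub_closed[OF assms(1,2) Y(1) assms(3) Y(3)]]
    by simp
  with ne show False
    by contradiction
qed

section \<open>Quantification as an infimum\<close>

text \<open>The values of \<open>\<sigma>'\<close> are finitely many terms with finite supports, so
  the infinite \<open>Z\<close> has a variable outside all of these supports and outside
  \<open>V\<close>. The last property, with a variable for \<open>d\<close>, is the side condition
  of P5; \<open>V\<close> leaves room for the support of a further formula.\<close>

lemma fresh_substitution:
  assumes "locally_finite_theory S A" and Z: "Z \<in> S" "infinite Z"
    and \<sigma>: "\<sigma> \<in> X \<rightarrow>\<^sub>E tms A Z" and "x \<in> X" "finite U" "finite V"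
  obtains \<sigma>' y where "\<sigma>' \<in> X \<rightarrow>\<^sub>E tms A Z" "\<forall>u\<in>U \<inter> X. \<sigma>' u = \<sigma> u"
    "y \<in> Z" "y \<notin> V" "\<forall>d\<in>tms A Z. comp_sub A X Z Z \<sigma>' (single A Z d y) = \<sigma>'"
proof -
  \<comment> \<open>Off \<open>U\<close> the value is the fixed term \<open>\<sigma> x\<close>,
    which keeps the image finite.\<close>
  define \<sigma>' where "\<sigma>' = (\<lambda>u\<in>X. if u \<in> U then \<sigma> u else \<sigma> x)"
  have \<sigma>': "\<sigma>' \<in> X \<rightarrow>\<^sub>E tms A Z"
    unfolding \<sigma>'_def using \<sigma> \<open>x \<in> X\<close> by auto
  have "\<sigma>' ` X \<subseteq> \<sigma> ` (U \<union> {x})"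
    unfolding \<sigma>'_def by auto
  then have fin: "finite (\<sigma>' ` X)"
    using \<open>finite U\<close> finite_subset by blast
  have "\<sigma>' ` X \<subseteq> tms A Z" "Z \<noteq> {}"
    using \<sigma>' Z by auto
  then have "\<forall>a\<in>\<sigma>' ` X. \<exists>T. finite T \<and> tm_support S A Z T a"
    using assms(1) Z(1) unfolding locally_finite_theory_def by blast
  then obtain T where T: "\<And>a. a \<in> \<sigma>' ` X \<Longrightarrow> finite (T a) \<and> tm_support S A Z (T a) a"
    using bchoice[of "\<sigma>' ` X" "\<lambda>a T. finite T \<and> tm_support S A Z T a"] by blast
  have "finite (\<Union> (T ` \<sigma>' ` X))"
    using T finite_UN_I[OF fin] by blast
  then have "finite (V \<union> \<Union> (T ` \<sigma>' ` X))"
    using \<open>finite V\<close> by simp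
  then have "\<not> Z \<subseteq> V \<union> \<Union> (T ` \<sigma>' ` X)"
    using Z(2) finite_subset by blast
  then obtain y where y: "y \<in> Z" "y \<notin> V \<union> \<Union> (T ` \<sigma>' ` X)"
    by blast
  have "comp_sub A X Z Z \<sigma>' (single A Z d y) = \<sigma>'" if "d \<in> tms A Z" for d
  proof
    fix u
    show "comp_sub A X Z Z \<sigma>' (single A Z d y) u = \<sigma>' u"
    proof (cases "u \<in> X")
      case True
      have "tsub A Z Z (\<sigma>' u) (single A Z d y) = \<sigma>' u"
        using y(2) T[OF imageI[OF True]] True
        by (intro tsub_single_fresh[OF Z(1) _ y(1) _ PiE_mem[OF \<sigma>' True] that]) auto
      then show ?thesis
        using True by (simp add: comp_sub_def)
    next
      case False
      then show ?thesis
        by (simp add: comp_sub_def \<sigma>'_def)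
    qed
  qed
  then show thesis
    using y(2) by (intro that[OF \<sigma>' _ y(1)]) (auto simp: \<sigma>'_def)
qed

lemma fall_fresh_variable:
  assumes lf: "locally_finite_theory S A" and Z: "Z \<in> S" "infinite Z"
    and X: "X \<in> S" "x \<in> X" and p: "p \<in> carrier (fms A X)"
    and \<sigma>: "\<sigma> \<in> X \<rightarrow>\<^sub>E tms A Z" and V: "finite V"
  obtains y q where "y \<in> Z" "y \<notin> V" "q \<in> carrier (fms A Z)"
    "fsub A X Z (fall A X x p) \<sigma> = fall A Z y q"
    "\<forall>d\<in>tms A Z. fsub A Z Z q (single A Z d y) = fsub A X Z p (\<sigma>(x := d))"
    "\<forall>d\<in>tms A Z. fsub A Z Z (fall A Z y q) (single A Z d y) = fall A Z y q"
proof -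
  have ne: "X \<noteq> {}" "Z \<noteq> {}"
    using X Z by auto
  have fall_p: "fall A X x p \<in> carrier (fms A X)"
    using fall_closed X p by blast
  obtain U where U: "finite U" "fm_support S A X U p"
    using locally_finite_fm_support[OF lf X(1) ne(1) p] .
  obtain U' where U': "finite U'" "fm_support S A X U' (fall A X x p)"
    using locally_finite_fm_support[OF lf X(1) ne(1) fall_p] .
  \<comment> \<open>Agreement on \<open>U'\<close> replaces \<open>\<sigma>\<close> by
    \<open>\<sigma>'\<close> under the quantified formula, agreement on \<open>U\<close> does so
    under \<open>p\<close>.\<close>
  have UU': "finite (U \<union> U')"
    using U U' by simp
  obtain \<sigma>' y where \<sigma>': "\<sigma>' \<in> X \<rightarrow>\<^sub>E tms A Z"
    and agree: "\<forall>u\<in>(U \<union> U') \<inter> X. \<sigma>' u = \<sigma> u"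
    and y: "y \<in> Z" "y \<notin> V"
    and fresh: "\<forall>d\<in>tms A Z. comp_sub A X Z Z \<sigma>' (single A Z d y) = \<sigma>'"
    using fresh_substitution[OF lf Z \<sigma> X(2) UU' V] .
  have subs: "U \<subseteq> X" "U' \<subseteq> X"
    using U U' unfolding fm_support_def by auto
  have var_y: "var A Z y \<in> tms A Z"
    using var_closed Z y by blast
  define q where "q = fsub A X Z p (\<sigma>'(x := var A Z y))"
  have upd: "\<sigma>'(x := var A Z y) \<in> X \<rightarrow>\<^sub>E tms A Z"
    using fun_upd_in[OF \<sigma>' X(2) var_y] .
  have q: "q \<in> carrier (fms A Z)"
    unfolding q_def using fsub_closed[OF X(1) ne(1) Z(1) p upd] .
  have "infinite (Z - {y})"
    using Z by simp
  then obtain z where z: "z \<in> Z" "z \<noteq> y"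
    by (metis Diff_iff finite.emptyI insertI1 ex_in_conv)
  have fall_\<sigma>': "fsub A X Z (fall A X x p) \<sigma>' = fall A Z y q"
    unfolding q_def using P5[OF X Z(1) \<sigma>' p y(1) z(1)] z(2) bspec[OF fresh var_closed[OF Z(1) z(1)]] by simp
  have "fsub A X Z (fall A X x p) \<sigma> = fsub A X Z (fall A X x p) \<sigma>'"
    using agree subs by (intro fm_supportD[OF U'(2) Z(1) \<sigma> \<sigma>']) auto
  moreover have "fsub A Z Z q (single A Z d y) = fsub A X Z p (\<sigma>(x := d))" if d: "d \<in> tms A Z" for d
  proof -
    have s: "single A Z d y \<in> Z \<rightarrow>\<^sub>E tms A Z"
      using single_in Z y d by blast
    \<comment> \<open>At \<open>x\<close> the composite sends \<open>y\<close> to \<open>d\<close>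
      by P3; at every other variable freshness of \<open>y\<close> leaves the value of
      \<open>\<sigma>'\<close> alone.\<close>
    have "comp_sub A X Z Z (\<sigma>'(x := var A Z y)) (single A Z d y) = \<sigma>'(x := d)"
    proof
      fix u
      show "comp_sub A X Z Z (\<sigma>'(x := var A Z y)) (single A Z d y) u = (\<sigma>'(x := d)) u"
        using fun_cong[OF bspec[OF fresh d], of u] P3[OF Z(1) y(1) Z(1) s] X
        by (auto simp: comp_sub_def single_def)
    qed
    then have "fsub A Z Z q (single A Z d y) = fsub A X Z p (\<sigma>'(x := d))"
      unfolding q_def using P2_fms[OF X(1) ne(1) Z(1) ne(2) Z(1) p upd s] by simp
    \<comment> \<open>Both updated maps send \<open>x\<close> to \<open>d\<close>, so they agree on
      \<open>U\<close> whether or not \<open>x\<close> lies in it.\<close>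
    also have "\<dots> = fsub A X Z p (\<sigma>(x := d))"
      using agree subs
      by (intro fm_supportD[OF U(2) Z(1)] fun_upd_in[OF \<sigma>' X(2) d] fun_upd_in[OF \<sigma> X(2) d]) auto
    finally show ?thesis .
  qed
  \<comment> \<open>\<open>fall A Z y q\<close> is the quantified formula under
    \<open>\<sigma>'\<close>, and composing \<open>\<sigma>'\<close> with a substitution for
    \<open>y\<close> gives \<open>\<sigma>'\<close> again.\<close>
  moreover have "fsub A Z Z (fall A Z y q) (single A Z d y) = fall A Z y q"
    if "d \<in> tms A Z" for d
    using P2_fms[OF X(1) ne(1) Z(1) ne(2) Z(1) fall_p \<sigma>' single_in[OF Z(1) y(1) that]]
      bspec[OF fresh that] fall_\<sigma>' by simp
  ultimately show thesis
    using that[OF y q] fall_\<sigma>' by simp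
qed

text \<open>This becomes M2 for \<open>modify_by A Z\<close>, whose terms and formulas over the
  empty set are those of \<open>A\<close> over \<open>Z\<close>.\<close>

lemma fall_is_glb:
  assumes lf: "locally_finite_theory S A" and Z: "Z \<in> S" "infinite Z"
    and X: "X \<in> S" "x \<in> X" and p: "p \<in> carrier (fms A X)"
    and \<sigma>: "\<sigma> \<in> X \<rightarrow>\<^sub>E tms A Z"
  shows "is_glb (fms A Z) (fsub A X Z (fall A X x p) \<sigma>)
           ((\<lambda>d. fsub A X Z p (\<sigma>(x := d))) ` tms A Z)"
proof (rule greatest_LowerI)
  have ne: "X \<noteq> {}" "Z \<noteq> {}"
    using X Z by auto
  show sub: "(\<lambda>d. fsub A X Z p (\<sigma>(x := d))) ` tms A Z \<subseteq> carrier (fms A Z)"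
    using fsub_closed[OF X(1) ne(1) Z(1) p fun_upd_in[OF \<sigma> X(2)]] by auto
  show "fsub A X Z (fall A X x p) \<sigma> \<in> carrier (fms A Z)"
    using fsub_closed fall_closed X ne Z p \<sigma> by blast
  fix r
  show "fsub A X Z (fall A X x p) \<sigma> \<sqsubseteq>\<^bsub>fms A Z\<^esub> r"
    if r: "r \<in> (\<lambda>d. fsub A X Z p (\<sigma>(x := d))) ` tms A Z"
  proof -
    obtain d where d: "d \<in> tms A Z" "r = fsub A X Z p (\<sigma>(x := d))"
      using r by blast
    obtain y q where yq: "y \<in> Z" "q \<in> carrier (fms A Z)"
      "fsub A X Z (fall A X x p) \<sigma> = fall A Z y q"
      "\<forall>d\<in>tms A Z. fsub A Z Z q (single A Z d y) = fsub A X Z p (\<sigma>(x := d))"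
      "\<forall>d\<in>tms A Z. fsub A Z Z (fall A Z y q) (single A Z d y) = fall A Z y q"
      using fall_fresh_variable[OF lf Z X p \<sigma> finite.emptyI] .
    \<comment> \<open>Substituting \<open>d\<close> for \<open>y\<close> in the Q2 inequality for
      \<open>q\<close> fixes its left side and turns its right side into \<open>r\<close>.\<close>
    show ?thesis
      using fsub_mono[OF Z(1) ne(2) Z(1) single_in[OF Z(1) yq(1) d(1)]
          fall_closed[OF Z(1) yq(1,2)] yq(2) Q2[OF Z(1) yq(1,2)]] yq(3-5) d by simp
  qed
  show "r \<sqsubseteq>\<^bsub>fms A Z\<^esub> fsub A X Z (fall A X x p) \<sigma>"
    if "r \<in> Lower (fms A Z) ((\<lambda>d. fsub A X Z p (\<sigma>(x := d))) ` tms A Z)"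
  proof -
    have r: "r \<in> carrier (fms A Z)"
      and below: "\<And>d. d \<in> tms A Z \<Longrightarrow> r \<sqsubseteq>\<^bsub>fms A Z\<^esub> fsub A X Z p (\<sigma>(x := d))"
      using that sub unfolding Lower_def by auto
    obtain V where V: "finite V" "fm_support S A Z V r"
      using locally_finite_fm_support[OF lf Z(1) ne(2) r] .
    \<comment> \<open>Here \<open>y\<close> and \<open>q\<close> depend on \<open>r\<close>, but
      \<open>fall A Z y q\<close> is the same element for every such choice. Avoiding
      \<open>V\<close> is what makes Q3 applicable to \<open>r\<close>.\<close>
    obtain y q where yq: "y \<in> Z" "y \<notin> V" "q \<in> carrier (fms A Z)"
      "fsub A X Z (fall A X x p) \<sigma> = fall A Z y q"
      "\<forall>d\<in>tms A Z. fsub A Z Z q (single A Z d y) = fsub A X Z p (\<sigma>(x := d))"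
      "\<forall>d\<in>tms A Z. fsub A Z Z (fall A Z y q) (single A Z d y) = fall A Z y q"
      using fall_fresh_variable[OF lf Z X p \<sigma> V(1)] .
    have "infinite (Z - {y})"
      using Z by simp
    then obtain z where z: "z \<in> Z" "z \<noteq> y"
      by (metis Diff_iff finite.emptyI insertI1 ex_in_conv)
    have var_y: "var A Z y \<in> tms A Z"
      using var_closed Z(1) yq(1) .
    have "fsub A Z Z r (single A Z (var A Z z) y) = r"
      using fsub_single_fresh[OF Z(1) V(2) yq(1,2) r var_closed[OF Z(1) z(1)]] .
    then have "fall A Z y r = r"
      using Q3[OF Z(1) yq(1) r z] by simp
    \<comment> \<open>The lower bound condition at \<open>d = var A Z y\<close>, where the
      substitution is the identity.\<close>
    moreover have "r \<sqsubseteq>\<^bsub>fms A Z\<^esub> q"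
      using below[OF var_y] bspec[OF yq(5) var_y] P1_fms[OF Z(1) ne(2) yq(3)] yq(1) by simp
    ultimately show ?thesis
      using fall_mono[OF Z(1) yq(1) r yq(3)] yq(4) by simp
  qed
qed

section \<open>Separating elements by substitutions into an infinite set\<close>

text \<open>Since \<open>U\<close> is finite, it injects into \<open>Z\<close>:
  \<open>\<sigma>\<close> renames along the injection and \<open>\<tau>\<close> renames back. Being
  inverse on \<open>U\<close> suffices for elements supported by \<open>U\<close>.\<close>

lemma finite_support_left_inverse:
  assumes X: "X \<in> S" "X \<noteq> {}" and Z: "Z \<in> S" "infinite Z" and U: "finite U" "U \<subseteq> X"
  obtains \<sigma> \<tau> where "\<sigma> \<in> X \<rightarrow>\<^sub>E tms A Z" "\<tau> \<in> Z \<rightarrow>\<^sub>E tms A X"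
    "\<forall>u\<in>U. comp_sub A X Z X \<sigma> \<tau> u = ident A X u"
proof -
  \<comment> \<open>Default variables: \<open>z\<close> for \<open>\<sigma>\<close> off
    \<open>U\<close>, and \<open>x\<close> for \<open>\<tau>\<close> off the image of
    \<open>U\<close>.\<close>
  obtain x z where xz: "x \<in> X" "z \<in> Z"
    using X Z by (metis ex_in_conv finite.emptyI)
  obtain T where T: "finite T" "card T = card U" "T \<subseteq> Z"
    using infinite_arbitrarily_large[OF Z(2)] by blast
  obtain g where g: "g ` U \<subseteq> Z" "inj_on g U"
    using card_le_inj[OF U(1) T(1)] T by auto
  have gZ: "g u \<in> Z" if "u \<in> U" for u
    using g(1) that by auto
  define \<sigma> where "\<sigma> = (\<lambda>u\<in>X. if u \<in> U then var A Z (g u) else var A Z z)"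
  define \<tau> where "\<tau> = (\<lambda>w\<in>Z. if w \<in> g ` U then var A X (inv_into U g w) else var A X x)"
  have "\<sigma> \<in> X \<rightarrow>\<^sub>E tms A Z"
    unfolding \<sigma>_def using gZ xz Z(1) by (auto intro!: var_closed)
  moreover have \<tau>: "\<tau> \<in> Z \<rightarrow>\<^sub>E tms A X"
    unfolding \<tau>_def using subsetD[OF U(2)] xz(1) X(1)
    by (auto intro!: var_closed simp: inv_into_into)
  moreover have "comp_sub A X Z X \<sigma> \<tau> u = ident A X u" if "u \<in> U" for u
  proof -
    have "g u \<in> Z" "u \<in> X"
      using that g U by auto
    then show ?thesis
      using P3[OF Z(1) _ X(1) \<tau>, of "g u"] that g(2)
      by (simp add: comp_sub_def ident_def \<sigma>_def \<tau>_def)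
  qed
  ultimately show thesis
    using that[of \<sigma> \<tau>] by simp
qed

text \<open>A single pair \<open>\<sigma>\<close>, \<open>\<tau>\<close> for the union of the two
  supports recovers both \<open>a\<close> and \<open>b\<close> from their images under
  \<open>\<sigma>\<close>, and these images coincide.\<close>

lemma tms_eqI:
  assumes lf: "locally_finite_theory S A" and X: "X \<in> S" "X \<noteq> {}" and Z: "Z \<in> S" "infinite Z"
    and a: "a \<in> tms A X" and b: "b \<in> tms A X"
    and eq: "\<And>\<sigma>. \<sigma> \<in> X \<rightarrow>\<^sub>E tms A Z \<Longrightarrow> tsub A X Z a \<sigma> = tsub A X Z b \<sigma>"
  shows "a = b"
proof -
  obtain U where U: "finite U" "tm_support S A X U a"
    using locally_finite_tm_support[OF lf X a] .
  obtain V where V: "finite V" "tm_support S A X V b"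
    using locally_finite_tm_support[OF lf X b] .
  have UV: "finite (U \<union> V)" "U \<union> V \<subseteq> X"
    using U V unfolding tm_support_def by auto
  obtain \<sigma> \<tau> where \<sigma>: "\<sigma> \<in> X \<rightarrow>\<^sub>E tms A Z" and \<tau>: "\<tau> \<in> Z \<rightarrow>\<^sub>E tms A X"
    and inv: "\<forall>u\<in>U \<union> V. comp_sub A X Z X \<sigma> \<tau> u = ident A X u"
    using finite_support_left_inverse[OF X Z UV] .
  have ne: "Z \<noteq> {}"
    using Z by auto
  have retract: "tsub A Z X (tsub A X Z c \<sigma>) \<tau> = c"
    if "c \<in> tms A X" "tm_support S A X T c" "T \<subseteq> U \<union> V" for c T
  proof -
    have "\<forall>u\<in>T. comp_sub A X Z X \<sigma> \<tau> u = ident A X u"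
      using inv that(3) by blast
    then have "tsub A X X c (comp_sub A X Z X \<sigma> \<tau>) = tsub A X X c (ident A X)"
      by (intro tm_supportD[OF that(2) X(1) comp_sub_in[OF Z(1) ne X(1) \<sigma> \<tau>] ident_in[OF X(1)]])
        (rule bspec)
    then show ?thesis
      using P2_tms[OF X Z(1) ne X(1) that(1) \<sigma> \<tau>] P1_tms[OF X that(1)] by simp
  qed
  have "a = tsub A Z X (tsub A X Z a \<sigma>) \<tau>"
    using retract[OF a U(2) Un_upper1] by (rule sym)
  also have "\<dots> = tsub A Z X (tsub A X Z b \<sigma>) \<tau>"
    using eq[OF \<sigma>] by simp
  also have "\<dots> = b"
    using retract[OF b V(2) Un_upper2] .
  finally show ?thesis .
qed

lemma fms_eqI:
  assumes lf: "locally_finite_theory S A" and X: "X \<in> S" "X \<noteq> {}" and Z: "Z \<in> S" "infinite Z"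
    and p: "p \<in> carrier (fms A X)" and q: "q \<in> carrier (fms A X)"
    and eq: "\<And>\<sigma>. \<sigma> \<in> X \<rightarrow>\<^sub>E tms A Z \<Longrightarrow> fsub A X Z p \<sigma> = fsub A X Z q \<sigma>"
  shows "p = q"
proof -
  obtain U where U: "finite U" "fm_support S A X U p"
    using locally_finite_fm_support[OF lf X p] .
  obtain V where V: "finite V" "fm_support S A X V q"
    using locally_finite_fm_support[OF lf X q] .
  have UV: "finite (U \<union> V)" "U \<union> V \<subseteq> X"
    using U V unfolding fm_support_def by auto
  obtain \<sigma> \<tau> where \<sigma>: "\<sigma> \<in> X \<rightarrow>\<^sub>E tms A Z" and \<tau>: "\<tau> \<in> Z \<rightarrow>\<^sub>E tms A X"
    and inv: "\<forall>u\<in>U \<union> V. comp_sub A X Z X \<sigma> \<tau> u = ident A X u"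
    using finite_support_left_inverse[OF X Z UV] .
  have ne: "Z \<noteq> {}"
    using Z by auto
  have retract: "fsub A Z X (fsub A X Z r \<sigma>) \<tau> = r"
    if "r \<in> carrier (fms A X)" "fm_support S A X T r" "T \<subseteq> U \<union> V" for r T
  proof -
    have "\<forall>u\<in>T. comp_sub A X Z X \<sigma> \<tau> u = ident A X u"
      using inv that(3) by blast
    then have "fsub A X X r (comp_sub A X Z X \<sigma> \<tau>) = fsub A X X r (ident A X)"
      by (intro fm_supportD[OF that(2) X(1) comp_sub_in[OF Z(1) ne X(1) \<sigma> \<tau>] ident_in[OF X(1)]])
        (rule bspec)
    then show ?thesis
      using P2_fms[OF X Z(1) ne X(1) that(1) \<sigma> \<tau>] P1_fms[OF X that(1)] by simp
  qed
  have "p = fsub A Z X (fsub A X Z p \<sigma>) \<tau>"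
    using retract[OF p U(2) Un_upper1] by (rule sym)
  also have "\<dots> = fsub A Z X (fsub A X Z q \<sigma>) \<tau>"
    using eq[OF \<sigma>] by simp
  also have "\<dots> = q"
    using retract[OF q V(2) Un_upper2] .
  finally show ?thesis .
qed

end

section \<open>The axioms for the modified theory\<close>

text \<open>Names the local function \<open>at\<close> of \<open>modify_by\<close>, so that
  simplification can express the modified data through those of \<open>A\<close>.\<close>

definition replace_empty :: "'v set \<Rightarrow> 'v set \<Rightarrow> 'v set" where
  "replace_empty Z X = (if X = {} then Z else X)"

lemma replace_empty_simps [simp]:
  "replace_empty Z {} = Z"
  "X \<noteq> {} \<Longrightarrow> replace_empty Z X = X"
  "x \<in> X \<Longrightarrow> replace_empty Z X = X"
  by (auto simp: replace_empty_def)

lemma replace_empty_in: "\<lbrakk>Z \<in> S; X \<in> S \<union> {{}}\<rbrakk> \<Longrightarrow> replace_empty Z X \<in> S"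
  by (auto simp: replace_empty_def)

lemma modify_by_simps [simp]:
  "tms (modify_by A Z) X = tms A (replace_empty Z X)"
  "fms (modify_by A Z) X = fms A (replace_empty Z X)"
  "var (modify_by A Z) = var A"
  "tsub (modify_by A Z) X Y = tsub A X (replace_empty Z Y)"
  "fsub (modify_by A Z) X Y = fsub A X (replace_empty Z Y)"
  "fall (modify_by A Z) = fall A"
  by (simp_all add: modify_by_def replace_empty_def)

lemma ident_modify_by [simp]: "ident (modify_by A Z) = ident A"
  by (simp add: ident_def fun_eq_iff)

lemma single_modify_by [simp]: "single (modify_by A Z) = single A"
  by (simp add: single_def fun_eq_iff)

lemma comp_sub_modify_by [simp]:
  "comp_sub (modify_by A Z) X Y W = comp_sub A X Y (replace_empty Z W)"
  by (simp add: comp_sub_def fun_eq_iff)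

context pre_quantifier_theory
begin

text \<open>In the axioms about substitution only the final target can be empty, since sources and
  intermediate sets are nonempty. Each such axiom is therefore an instance of the same axiom of
  \<open>A\<close> with target \<open>replace_empty Z Y\<close> or
  \<open>replace_empty Z W\<close>.\<close>

lemma pre_quantifier_theory_modify_by:
  assumes Z: "Z \<in> S"
  shows "pre_quantifier_theory (S \<union> {{}}) (modify_by A Z)"
proof (rule pre_quantifier_theory.intro, goal_cases)
  case 1
  then show ?case
    using infinite_member by blast
next
  case (2 X x)
  then show ?case
    using var_closed[of X x] by auto
next
  case (3 X)
  then show ?case
    using boolean_fms[of "replace_empty Z X"] replace_empty_in[OF Z, of X] by auto
next
  case (4 X Y a \<sigma>)
  then show ?case
    using tsub_closed[of X "replace_empty Z Y" a \<sigma>] replace_empty_in[OF Z, of Y] by auto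
next
  case (5 X Y p \<sigma>)
  then show ?case
    using fsub_closed[of X "replace_empty Z Y" p \<sigma>] replace_empty_in[OF Z, of Y] by auto
next
  case (6 X x p)
  then show ?case
    using fall_closed[of X x p] by auto
next
  case (7 X a)
  then show ?case
    using P1_tms[of X a] by auto
next
  case (8 X p)
  then show ?case
    using P1_fms[of X p] by auto
next
  case (9 X Y W a \<sigma> \<tau>)
  then show ?case
    using P2_tms[of X Y "replace_empty Z W" a \<sigma> \<tau>] replace_empty_in[OF Z, of W] by auto
next
  case (10 X Y W p \<sigma> \<tau>)
  then show ?case
    using P2_fms[of X Y "replace_empty Z W" p \<sigma> \<tau>] replace_empty_in[OF Z, of W] by auto
next
  case (11 X x Y \<sigma>)
  then show ?case
    using P3[of X x "replace_empty Z Y" \<sigma>] replace_empty_in[OF Z, of Y] by auto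
next
  case (12 X Y \<sigma>)
  then show ?case
    using P4[of X "replace_empty Z Y" \<sigma>] replace_empty_in[OF Z, of Y] by auto
next
  \<comment> \<open>Here \<open>y\<close> lies in \<open>Y\<close>, so the target is nonempty and P5
    is used for \<open>Y\<close> itself.\<close>
  case (13 X x Y \<sigma> p y z)
  then show ?case
    using P5[of X x Y \<sigma> p y z] by auto
next
  case (14 X x p q)
  then show ?case
    using Q1[of X x p q] by auto
next
  case (15 X x p)
  then show ?case
    using Q2[of X x p] by auto
next
  case (16 X x p y)
  then show ?case
    using Q3[of X x p y] by auto
qed

end

section \<open>Assembling the faithful model\<close>

theorem theorem5:
  fixes S :: "'v set set" and A :: "('v, 't, 'p) qtheory" and Z :: "'v set"
  assumes "quantifier_theory S A"
    and "locally_finite_theory S A"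
    and "Z \<in> S" and "infinite Z"
  shows "modification_of S A (modify_by A Z) \<and> model_of S A (modify_by A Z) \<and>
         faithful_theory (S \<union> {{}}) (modify_by A Z)"
proof -
  interpret A: quantifier_theory S A
    using assms(1) .
  note lf = assms(2) and Z = assms(3,4)
  let ?B = "modify_by A Z"
  have "Z \<noteq> {}"
    using Z by auto
  then obtain z where z: "z \<in> Z"
    by blast
  have "infinite (Z - {z})"
    using Z by simp
  then obtain z' where z': "z' \<in> Z" "z \<noteq> z'"
    by (metis Diff_iff finite.emptyI insertI1 ex_in_conv)
  \<comment> \<open>This \<open>p\<close> serves twice: it witnesses nontriviality of
    \<open>?B\<close>, and it separates bottom from top over \<open>Z\<close> for M1.\<close>
  obtain X p where X: "X \<in> S" "X \<noteq> {}" and p: "p \<in> carrier (fms A X)"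
    and not_closed: "\<not> fm_closed S A X p"
    using A.nontrivial by blast
  \<comment> \<open>If the empty set is in \<open>S\<close>, two values of \<open>p\<close> in
    \<open>A\<close> might differ only there, where \<open>?B\<close> has other data. By
    \<open>closed_over_nonempty_sets\<close>, equality over the nonempty sets would already make
    \<open>p\<close> closed in \<open>A\<close>.\<close>
  have "\<not> fm_support (S \<union> {{}}) ?B X {} p"
  proof
    assume supp: "fm_support (S \<union> {{}}) ?B X {} p"
    have "fsub A X Y p \<sigma> = fsub A X Y p \<tau>"
      if "Y \<in> S" "Y \<noteq> {}" "\<sigma> \<in> X \<rightarrow>\<^sub>E tms A Y" "\<tau> \<in> X \<rightarrow>\<^sub>E tms A Y" for Y \<sigma> \<tau>
      using fm_supportD[OF supp, of Y \<sigma> \<tau>] that by simp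
    then have "fm_support S A X {} p"
      using A.closed_over_nonempty_sets[OF X Z(1) z z' p] unfolding fm_support_def by blast
    then show False
      using not_closed by (simp add: fm_closed_def)
  qed
  then have "\<not> fm_closed (S \<union> {{}}) ?B X p"
    using X by (simp add: fm_closed_def)
  then have "\<exists>X\<in>S \<union> {{}}. X \<noteq> {} \<and> (\<exists>p\<in>carrier (fms ?B X). \<not> fm_closed (S \<union> {{}}) ?B X p)"
    using X p by (intro bexI[of _ X]) auto
  then interpret B: quantifier_theory "S \<union> {{}}" ?B
    using A.pre_quantifier_theory_modify_by[OF Z(1)]
    by (intro quantifier_theory.intro quantifier_theory_axioms.intro)
  have "quantifier_model (S \<union> {{}}) ?B"
  proof
    show "tms ?B {} \<noteq> {}"
      using A.var_closed Z z by auto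
    show "\<bottom>\<^bsub>fms ?B {}\<^esub> \<noteq> \<top>\<^bsub>fms ?B {}\<^esub>"
      using A.nontrivial_fms[OF X p not_closed Z(1)] z by auto
  next
    fix X x p \<sigma>
    assume "X \<in> S \<union> {{}}" "x \<in> X" "p \<in> carrier (fms ?B X)" "\<sigma> \<in> X \<rightarrow>\<^sub>E tms ?B {}"
    then show "is_glb (fms ?B {}) (fsub ?B X {} (fall ?B X x p) \<sigma>)
        ((\<lambda>d. fsub ?B X {} p (\<sigma>(x := d))) ` tms ?B {})"
      using A.fall_is_glb[OF lf Z, of X x p \<sigma>] by auto
  qed auto
  moreover have "agree_on (S - {{}}) A ?B"
    unfolding agree_on_def by simp
  moreover have "faithful_theory (S \<union> {{}}) ?B"
    unfolding faithful_theory_def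
  proof (intro conjI ballI impI)
    show "tms ?B {} \<noteq> {}"
      using A.var_closed[OF Z(1) z] by auto
  next
    fix X a b
    assume "X \<in> S \<union> {{}}" "X \<noteq> {}" "a \<in> tms ?B X" "b \<in> tms ?B X"
    then show "a = b \<longleftrightarrow> (\<forall>\<sigma>\<in>X \<rightarrow>\<^sub>E tms ?B {}. tsub ?B X {} a \<sigma> = tsub ?B X {} b \<sigma>)"
      using A.tms_eqI[OF lf _ _ Z, of X a b] by simp blast
  next
    fix X p q
    assume "X \<in> S \<union> {{}}" "X \<noteq> {}" "p \<in> carrier (fms ?B X)" "q \<in> carrier (fms ?B X)"
    then show "p = q \<longleftrightarrow> (\<forall>\<sigma>\<in>X \<rightarrow>\<^sub>E tms ?B {}. fsub ?B X {} p \<sigma> = fsub ?B X {} q \<sigma>)"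
      using A.fms_eqI[OF lf _ _ Z, of X p q] by simp blast
  qed
  ultimately show ?thesis
    unfolding modification_of_def model_of_def using B.quantifier_theory_axioms by blast
qed

end
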